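(* Let $X$ be a path connected topological space and let $x\in X$. Then the following statements are equivalent: (1) $X$ is homotopically path Hausdorff; (2) $\pi_1^{qs}(X,x)=1$; (3) for all $[f]\in\pi_1(X,x)$ and every loop $g$ at $x$, if $f\xrightarrow{close} g$ rel $\dot I$, then $[f]=[g]$; (4) for all $[f]\in\pi_1(X,x)$ and all loops $g_1,g_2$ at $x$, if $f\xrightarrow{close} g_1$ rel $\dot I$ and $f\xrightarrow{close} g_2$ rel $\dot I$, then $[g_1]=[g_2]$.
   Context: All spaces are assumed path connected. $I=[0,1]$, $\dot I=\{0,1\}$; $\simeq$ rel $\dot I$ denotes homotopy of paths relative to endpoints, and $[f]$ is the homotopy class of a path $f$ rel $\dot I$. $*$ is concatenation of paths, $g^{-1}$ is the reverse path, $c_x$ is the constant path at $x$, and $P(X,x)$ is the set of all paths in $X$ with initial point $x$. Closeness: let $f,g:I\to X$ be paths with $f(0)=g(0)$ and $f(1)=g(1)$. We say $f$ is homotopically close to $g$ rel $\dot I$ (written $f\xrightarrow{close} g$ rel $\dot I$) if for every partition $0=t_0<t_1<\cdots<t_n=1$ and every sequence of open sets $U_1,\ldots,U_n$ of $X$ with $g([t_{i-1},t_i])\subset U_i$ for all $i$, there is a path $\gamma$ with $\gamma([t_{i-1},t_i])\subset U_i$ for $1\le i\le n$, $\gamma(t_i)=g(t_i)$ for $0\le i\le n$, and $\gamma\simeq f$ rel $\dot I$. $\pi_1^{qs}(X,x)=\{[f]\in\pi_1(X,x): f\xrightarrow{close} f' \text{ rel } \dot I \text{ for some } f'\in[c_x]\}$.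 $X$ is homotopically path Hausdorff relative to a subset $H\subseteq\pi_1(X,x)$ if for every pair of paths $\alpha,\beta\in P(X,x)$ with $\alpha(1)=\beta(1)$ and $[\alpha*\beta^{-1}]\notin H$, there are a partition $0=t_0<t_1<\cdots<t_n=1$ and open sets $U_1,\ldots,U_n$ with $\alpha([t_{i-1},t_i])\subset U_i$ such that for every path $\gamma:[0,1]\to X$ satisfying $\gamma([t_{i-1},t_i])\subset U_i$ for $1\le i\le n$ and $\gamma(t_i)=\alpha(t_i)$ for $0\le i\le n$, one has $[\gamma*\beta^{-1}]\notin H$. $X$ is homotopically path Hausdorff if it is homotopically path Hausdorff relative to the trivial subgroup of $\pi_1(X,x)$. *)

theory Defs
  imports "HOL-Analysis.Analysis"
begin

text \<open>
  The ambient space X is the whole type, a topological space, so that paths in X are the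
  library's \<^term>\<open>path\<close>s and homotopy relative to the endpoints is
  \<^term>\<open>homotopic_paths UNIV\<close>. Values of a path outside the unit interval are irrelevant
  to all the notions below.
\<close>

definition path_class :: "(real \<Rightarrow> 'a::topological_space) \<Rightarrow> (real \<Rightarrow> 'a) set" where
  "path_class f = {g. homotopic_paths UNIV f g}"

definition paths_from :: "'a::topological_space \<Rightarrow> (real \<Rightarrow> 'a) set" where
  "paths_from x = {f. path f \<and> pathstart f = x}"

definition loops_at :: "'a::topological_space \<Rightarrow> (real \<Rightarrow> 'a) set" where
  "loops_at x = {f. path f \<and> pathstart f = x \<and> pathfinish f = x}"

definition const_path :: "'a \<Rightarrow> real \<Rightarrow> 'a" where
  "const_path x = (\<lambda>_. x)"

text \<open>
  Only the underlying set of the fundamental group is needed: its group structure enters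
  solely through the trivial subgroup, which is the singleton of the class of the constant loop.
\<close>

definition fundamental_group :: "'a::topological_space \<Rightarrow> (real \<Rightarrow> 'a) set set" where
  "fundamental_group x = path_class ` loops_at x"

definition trivial_subgroup :: "'a::topological_space \<Rightarrow> (real \<Rightarrow> 'a) set set" where
  "trivial_subgroup x = {path_class (const_path x)}"

text \<open>The conditions force \<open>n \<ge> 1\<close>; values \<open>t i\<close> with \<open>i > n\<close> are irrelevant.\<close>

definition unit_partition :: "nat \<Rightarrow> (nat \<Rightarrow> real) \<Rightarrow> bool" where
  "unit_partition n t \<longleftrightarrow> t 0 = 0 \<and> t n = 1 \<and> (\<forall>i\<in>{1..n}. t (i - 1) < t i)"

definition subordinate ::
    "nat \<Rightarrow> (nat \<Rightarrow> real) \<Rightarrow> (nat \<Rightarrow> 'a set) \<Rightarrow> (real \<Rightarrow> 'a) \<Rightarrow> bool" where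
  "subordinate n t U g \<longleftrightarrow> (\<forall>i\<in>{1..n}. g ` {t (i - 1)..t i} \<subseteq> U i)"

definition homotopically_close ::
    "(real \<Rightarrow> 'a::topological_space) \<Rightarrow> (real \<Rightarrow> 'a) \<Rightarrow> bool" where
  "homotopically_close f g \<longleftrightarrow>
     path f \<and> path g \<and> pathstart f = pathstart g \<and> pathfinish f = pathfinish g \<and>
     (\<forall>n t U. unit_partition n t \<longrightarrow> (\<forall>i\<in>{1..n}. open (U i)) \<longrightarrow> subordinate n t U g \<longrightarrow>
        (\<exists>\<gamma>. path \<gamma> \<and> subordinate n t U \<gamma> \<and> (\<forall>i\<in>{0..n}. \<gamma> (t i) = g (t i)) \<and>
             homotopic_paths UNIV \<gamma> f))"

definition pi1_qs :: "'a::topological_space \<Rightarrow> (real \<Rightarrow> 'a) set set" where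
  "pi1_qs x = {path_class f | f. path_class f \<in> fundamental_group x \<and>
                 (\<exists>f'\<in>path_class (const_path x). homotopically_close f f')}"

definition homotopically_path_Hausdorff_rel ::
    "'a::topological_space \<Rightarrow> (real \<Rightarrow> 'a) set set \<Rightarrow> bool" where
  "homotopically_path_Hausdorff_rel x H \<longleftrightarrow>
     (\<forall>\<alpha>\<in>paths_from x. \<forall>\<beta>\<in>paths_from x.
        pathfinish \<alpha> = pathfinish \<beta> \<longrightarrow> path_class (\<alpha> +++ reversepath \<beta>) \<notin> H \<longrightarrow>
        (\<exists>n t U. unit_partition n t \<and> (\<forall>i\<in>{1..n}. open (U i)) \<and> subordinate n t U \<alpha> \<and>
           (\<forall>\<gamma>. path \<gamma> \<longrightarrow> subordinate n t U \<gamma> \<longrightarrow> (\<forall>i\<in>{0..n}. \<gamma> (t i) = \<alpha> (t i)) \<longrightarrow>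
              path_class (\<gamma> +++ reversepath \<beta>) \<notin> H)))"

definition homotopically_path_Hausdorff :: "'a::topological_space \<Rightarrow> bool" where
  "homotopically_path_Hausdorff x \<longleftrightarrow> homotopically_path_Hausdorff_rel x (trivial_subgroup x)"

end

theory Submission
  imports Defs
begin

text \<open>
  The idea is that homotopical path Hausdorffness is a closeness condition in disguise. For paths
  \<open>\<alpha>, \<beta>\<close> from \<open>x\<close> with a common end, the class of \<open>\<gamma> * \<beta>\<inverse>\<close> is trivial exactly when \<open>\<gamma> \<simeq> \<beta>\<close>, so the
  failure of the separating condition for \<open>\<alpha>, \<beta>\<close> says that every subdivision and open cover along
  \<open>\<alpha>\<close> admits an interpolating \<open>\<gamma> \<simeq> \<beta>\<close>, that is, \<open>\<beta>\<close> is close to \<open>\<alpha>\<close>. Hence the space is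
  homotopically path Hausdorff iff a path from \<open>x\<close> is homotopic to every path it is close to
  (\<open>homotopically_path_Hausdorff_iff_close\<close>).

  Restricted to loops, this says that close loops are homotopic; restricted further to loops
  close to a null-homotopic one, it says that \<open>pi1_qs x\<close> is trivial. The way back from there to
  arbitrary paths rests on one geometric fact, \<open>homotopically_close_join\<close>: closeness survives
  appending a common path. If \<open>\<beta>\<close> is close to \<open>\<alpha>\<close>, then the loop \<open>\<beta> * \<alpha>\<inverse>\<close> is close to the
  null-homotopic loop \<open>\<alpha> * \<alpha>\<inverse>\<close>; if \<open>pi1_qs x\<close> is trivial, it is itself null-homotopic and
  cancellation gives \<open>\<beta> \<simeq> \<alpha>\<close>.

  That close loops are homotopic is the same as uniqueness, up to homotopy, of the loop that a
  given loop is close to, because every loop is close to itself.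
\<close>

section \<open>Cancellation of paths up to homotopy\<close>

text \<open>
  The group laws for a path \<open>p\<close> in a space without linear structure are the images under \<open>p\<close> of
  the same laws for the identity path of the unit interval.
\<close>

lemma homotopic_paths_join_const:
  fixes p :: "real \<Rightarrow> 'a::topological_space"
  assumes "path p"
  shows "homotopic_paths UNIV (p +++ const_path (pathfinish p)) p"
proof -
  let ?I = "linepath 0 (1::real)"
  have "homotopic_paths {0..1} (?I +++ linepath 1 1) ?I"
    by (rule homotopic_paths_rid') (auto simp: closed_segment_eq_real_ivl)
  then have "homotopic_paths UNIV (p \<circ> (?I +++ linepath 1 1)) (p \<circ> ?I)"
    using assms by (intro homotopic_paths_continuous_image) (auto simp: path_def)
  moreover have "p \<circ> (?I +++ linepath 1 1) = p +++ const_path (pathfinish p)" "p \<circ> ?I = p"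
    by (auto simp: fun_eq_iff joinpaths_def linepath_def const_path_def pathfinish_def)
  ultimately show ?thesis
    by simp
qed

lemma homotopic_paths_join_reversepath:
  fixes p :: "real \<Rightarrow> 'a::topological_space"
  assumes "path p"
  shows "homotopic_paths UNIV (p +++ reversepath p) (const_path (pathstart p))"
proof -
  let ?I = "linepath 0 (1::real)"
  have "homotopic_paths {0..1} (?I +++ reversepath ?I) (linepath (pathstart ?I) (pathstart ?I))"
    by (rule homotopic_paths_rinv) (auto simp: closed_segment_eq_real_ivl)
  then have "homotopic_paths UNIV (p \<circ> (?I +++ reversepath ?I)) (p \<circ> linepath 0 0)"
    using assms by (intro homotopic_paths_continuous_image) (auto simp: path_def)
  moreover have "p \<circ> (?I +++ reversepath ?I) = p +++ reversepath p"
    by (auto simp: fun_eq_iff joinpaths_def linepath_def reversepath_def)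
  moreover have "p \<circ> linepath 0 0 = const_path (pathstart p)"
    by (auto simp: fun_eq_iff linepath_def const_path_def pathstart_def)
  ultimately show ?thesis
    by simp
qed

lemma homotopic_paths_const_join:
  fixes p :: "real \<Rightarrow> 'a::topological_space"
  assumes "path p"
  shows "homotopic_paths UNIV (const_path (pathstart p) +++ p) p"
proof -
  have "homotopic_paths UNIV (reversepath p +++ const_path (pathstart p)) (reversepath p)"
    using homotopic_paths_join_const[of "reversepath p"] assms by simp
  then have "homotopic_paths UNIV
      (reversepath (reversepath p +++ const_path (pathstart p))) (reversepath (reversepath p))"
    by (rule homotopic_paths_reversepath_D)
  moreover have "reversepath (reversepath p +++ const_path (pathstart p))
      = reversepath (const_path (pathstart p)) +++ p"
    by (subst reversepath_joinpaths)
       (auto simp: const_path_def pathstart_def pathfinish_def reversepath_def)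
  moreover have "reversepath (const_path (pathstart p)) = const_path (pathstart p)"
    by (simp add: reversepath_def const_path_def)
  ultimately show ?thesis
    by simp
qed

lemma homotopic_paths_join_reversepath_iff:
  fixes p q :: "real \<Rightarrow> 'a::topological_space"
  assumes "path p" "path q" "pathstart p = pathstart q" "pathfinish p = pathfinish q"
  shows "homotopic_paths UNIV (p +++ reversepath q) (const_path (pathstart p))
     \<longleftrightarrow> homotopic_paths UNIV p q"
proof
  assume null: "homotopic_paths UNIV (p +++ reversepath q) (const_path (pathstart p))"
  have "homotopic_paths UNIV p (p +++ const_path (pathfinish q))"
    using homotopic_paths_sym[OF homotopic_paths_join_const[of p]] assms by simp
  also have "homotopic_paths UNIV \<dots> (p +++ (reversepath q +++ q))"
  proof (rule homotopic_paths_join)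
    show "homotopic_paths UNIV (const_path (pathfinish q)) (reversepath q +++ q)"
      using homotopic_paths_sym[OF homotopic_paths_join_reversepath[of "reversepath q"]] assms
      by simp
  qed (use assms in \<open>auto simp: const_path_def pathstart_def\<close>)
  also have "homotopic_paths UNIV \<dots> ((p +++ reversepath q) +++ q)"
    using assms by (intro homotopic_paths_assoc) auto
  also have "homotopic_paths UNIV \<dots> (const_path (pathstart q) +++ q)"
    using null assms by (intro homotopic_paths_join) auto
  also have "homotopic_paths UNIV \<dots> q"
    using assms by (intro homotopic_paths_const_join)
  finally show "homotopic_paths UNIV p q" .
next
  assume "homotopic_paths UNIV p q"
  then have "homotopic_paths UNIV (p +++ reversepath q) (q +++ reversepath q)"
    using assms by (intro homotopic_paths_join) auto
  also have "homotopic_paths UNIV \<dots> (const_path (pathstart p))"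
    using homotopic_paths_join_reversepath[of q] assms by simp
  finally show "homotopic_paths UNIV (p +++ reversepath q) (const_path (pathstart p))" .
qed

section \<open>Classes of paths\<close>

lemma path_class_eq_iff:
  assumes "path f"
  shows "path_class f = path_class g \<longleftrightarrow> homotopic_paths UNIV f g"
proof
  assume "path_class f = path_class g"
  moreover have "f \<in> path_class f"
    using assms by (simp add: path_class_def)
  ultimately show "homotopic_paths UNIV f g"
    by (auto simp: path_class_def intro: homotopic_paths_sym)
next
  assume "homotopic_paths UNIV f g"
  then show "path_class f = path_class g"
    unfolding path_class_def by (blast intro: homotopic_paths_sym homotopic_paths_trans)
qed

lemma path_class_in_fundamental_group_iff:
  "path_class f \<in> fundamental_group x \<longleftrightarrow> f \<in> loops_at x"
proof
  assume "path_class f \<in> fundamental_group x"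
  then obtain h where h: "h \<in> loops_at x" "path_class h = path_class f"
    by (auto simp: fundamental_group_def)
  then have "homotopic_paths UNIV h f"
    using path_class_eq_iff[of h f] by (simp add: loops_at_def)
  with h(1) show "f \<in> loops_at x"
    using homotopic_paths_imp_path homotopic_paths_imp_pathstart homotopic_paths_imp_pathfinish
    by (fastforce simp: loops_at_def)
qed (simp add: fundamental_group_def)

lemma const_path_in_loops_at [simp]: "const_path x \<in> loops_at x"
  by (simp add: loops_at_def const_path_def path_def pathstart_def pathfinish_def)

lemma path_class_join_reversepath_trivial_iff:
  assumes "path p" "path q" "pathstart p = x" "pathstart q = x" "pathfinish p = pathfinish q"
  shows "path_class (p +++ reversepath q) \<in> trivial_subgroup x \<longleftrightarrow> homotopic_paths UNIV p q"
  using assms homotopic_paths_join_reversepath_iff[of p q]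
  by (simp add: trivial_subgroup_def path_class_eq_iff)

section \<open>Closeness of paths\<close>

lemma homotopically_close_refl:
  fixes f :: "real \<Rightarrow> 'a::topological_space"
  assumes "path f"
  shows "homotopically_close f f"
  unfolding homotopically_close_def
proof (intro conjI allI impI)
  fix n t and U :: "nat \<Rightarrow> 'a set"
  assume "subordinate n t U f"
  with assms show "\<exists>\<gamma>. path \<gamma> \<and> subordinate n t U \<gamma> \<and> (\<forall>i\<in>{0..n}. \<gamma> (t i) = f (t i)) \<and>
      homotopic_paths UNIV \<gamma> f"
    by (intro exI[of _ f]) simp
qed (use assms in auto)

text \<open>
  A cover along \<open>g * h\<close> restricts to a cover along \<open>g\<close>: the pieces that start before \<open>1/2\<close>,
  stretched by \<open>2\<close>, with the last of them cut off at \<open>1/2\<close>. An interpolation of \<open>g\<close> for this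
  cover, followed by \<open>h\<close> itself, interpolates \<open>g * h\<close>.
\<close>

lemma homotopically_close_join:
  fixes f g h :: "real \<Rightarrow> 'a::topological_space"
  assumes close: "homotopically_close f g" and h: "path h" "pathfinish g = pathstart h"
  shows "homotopically_close (f +++ h) (g +++ h)"
  unfolding homotopically_close_def
proof (intro conjI allI impI)
  have fg: "path f" "path g" "pathstart f = pathstart g" "pathfinish f = pathfinish g"
    using close by (auto simp: homotopically_close_def)
  show "path (f +++ h)" "path (g +++ h)" "pathstart (f +++ h) = pathstart (g +++ h)"
    "pathfinish (f +++ h) = pathfinish (g +++ h)"
    using fg h by auto
  fix n t and U :: "nat \<Rightarrow> 'a set"
  assume part: "unit_partition n t" and opn: "\<forall>i\<in>{1..n}. open (U i)"
    and sub: "subordinate n t U (g +++ h)"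
  have t0: "t 0 = 0" and tn: "t n = 1" and step: "\<And>i. i \<in> {1..n} \<Longrightarrow> t (i - 1) < t i"
    using part by (auto simp: unit_partition_def)
  \<comment> \<open>The first \<open>k\<close> pieces are those that start before the joint; \<open>t k\<close> may lie beyond it.\<close>
  define k where "k = (LEAST i. 1/2 \<le> t i)"
  have tk: "1/2 \<le> t k"
    unfolding k_def by (rule LeastI[of _ n]) (simp add: tn)
  have below: "t i < 1/2" if "i < k" for i
    using not_less_Least[of i "\<lambda>i. 1/2 \<le> t i"] that by (simp add: k_def)
  have kn: "k \<le> n"
    unfolding k_def by (rule Least_le) (simp add: tn)
  have k0: "0 < k"
    using tk t0 by (cases k) auto
  have beyond: "1/2 \<le> t i" if "k \<le> i" "i \<le> n" for i
    using that
  proof (induction i rule: dec_induct)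
    case base
    show ?case by (rule tk)
  next
    case (step i)
    then show ?case using \<open>\<And>i. i \<in> {1..n} \<Longrightarrow> t (i - 1) < t i\<close>[of "Suc i"] by simp
  qed
  define s where "s i = (if i < k then 2 * t i else 1)" for i
  have s_part: "unit_partition k s"
    unfolding unit_partition_def
  proof (intro conjI ballI)
    show "s 0 = 0" "s k = 1"
      using k0 t0 by (auto simp: s_def)
    fix i assume i: "i \<in> {1..k}"
    then show "s (i - 1) < s i"
      using step[of i] kn below[of "i - 1"] by (auto simp: s_def)
  qed
  have s_sub: "subordinate k s U g"
    unfolding subordinate_def
  proof (intro ballI subsetI)
    fix i y assume i: "i \<in> {1..k}" and "y \<in> g ` {s (i - 1)..s i}"
    then obtain u where u: "s (i - 1) \<le> u" "u \<le> s i" "y = g u"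
      by auto
    have "t (i - 1) \<le> u / 2" "u / 2 \<le> t i" "u / 2 \<le> 1/2"
      using u i tk below[of i] by (auto simp: s_def split: if_splits)
    moreover have "(g +++ h) (u / 2) = y"
      using \<open>u / 2 \<le> 1/2\<close> u by (simp add: joinpaths_def)
    ultimately show "y \<in> U i"
      using sub i kn by (force simp: subordinate_def)
  qed
  have "\<forall>i\<in>{1..k}. open (U i)"
    using opn kn by auto
  with close s_part s_sub obtain \<gamma> where \<gamma>: "path \<gamma>" "subordinate k s U \<gamma>"
      "\<And>i. i \<in> {0..k} \<Longrightarrow> \<gamma> (s i) = g (s i)" "homotopic_paths UNIV \<gamma> f"
    unfolding homotopically_close_def by blast
  have fin: "\<gamma> 1 = g 1"
    using \<gamma>(3)[of k] by (simp add: s_def)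
  have second_half: "(\<gamma> +++ h) u = (g +++ h) u" if "1/2 \<le> u" for u
  proof (cases "u = 1/2")
    case True
    then have "2 * u = 1"
      by simp
    then show ?thesis
      using fin by (simp only: joinpaths_def split: if_split)
  qed (use that in \<open>auto simp: joinpaths_def\<close>)
  show "\<exists>\<gamma>. path \<gamma> \<and> subordinate n t U \<gamma> \<and> (\<forall>i\<in>{0..n}. \<gamma> (t i) = (g +++ h) (t i)) \<and>
             homotopic_paths UNIV \<gamma> (f +++ h)"
  proof (intro exI conjI ballI)
    have \<gamma>h: "pathfinish \<gamma> = pathstart h"
      using fin h by (simp add: pathfinish_def)
    then show "path (\<gamma> +++ h)"
      using \<gamma>(1) h by simp
    show "homotopic_paths UNIV (\<gamma> +++ h) (f +++ h)"
      using \<gamma>(4) h \<gamma>h by (intro homotopic_paths_join) auto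
    show "subordinate n t U (\<gamma> +++ h)"
      unfolding subordinate_def
    proof (intro ballI subsetI)
      fix i y assume i: "i \<in> {1..n}" and "y \<in> (\<gamma> +++ h) ` {t (i - 1)..t i}"
      then obtain u where u: "t (i - 1) \<le> u" "u \<le> t i" "y = (\<gamma> +++ h) u"
        by auto
      show "y \<in> U i"
      proof (cases "u < 1/2")
        case True
        then have "i - 1 < k"
          using u i beyond[of "i - 1"] by force
        then have "i \<in> {1..k}"
          using i by auto
        moreover from this have "2 * u \<in> {s (i - 1)..s i}"
          using u True by (auto simp: s_def)
        ultimately have "\<gamma> (2 * u) \<in> U i"
          using \<gamma>(2) unfolding subordinate_def by blast
        then show ?thesis
          using True u by (simp add: joinpaths_def)
      next
        case False
        then show ?thesis
          using second_half[of u] u i sub by (force simp: subordinate_def)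
      qed
    qed
    fix i assume i: "i \<in> {0..n}"
    show "(\<gamma> +++ h) (t i) = (g +++ h) (t i)"
    proof (cases "i < k")
      case True
      then show ?thesis
        using \<gamma>(3)[of i] below[of i] by (simp add: joinpaths_def s_def)
    next
      case False
      then show ?thesis
        using i beyond[of i] second_half by auto
    qed
  qed
qed

section \<open>Homotopical path Hausdorffness in terms of closeness\<close>

text \<open>
  For fixed \<open>\<alpha>, \<beta>\<close> the separating subdivision and cover exist exactly when \<open>\<beta>\<close> is not close to
  \<open>\<alpha>\<close>, since an interpolation \<open>\<gamma>\<close> of \<open>\<alpha>\<close> has \<open>\<gamma> * \<beta>\<inverse>\<close> null-homotopic iff \<open>\<gamma> \<simeq> \<beta>\<close>.
\<close>

lemma homotopically_path_Hausdorff_iff_close: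
  fixes x :: "'a::topological_space"
  shows "homotopically_path_Hausdorff x \<longleftrightarrow>
    (\<forall>\<alpha>\<in>paths_from x. \<forall>\<beta>\<in>paths_from x. homotopically_close \<beta> \<alpha> \<longrightarrow> homotopic_paths UNIV \<beta> \<alpha>)"
proof -
  have key: "(pathfinish \<alpha> = pathfinish \<beta> \<longrightarrow>
      path_class (\<alpha> +++ reversepath \<beta>) \<notin> trivial_subgroup x \<longrightarrow>
        (\<exists>n t U. unit_partition n t \<and> (\<forall>i\<in>{1..n}. open (U i)) \<and> subordinate n t U \<alpha> \<and>
           (\<forall>\<gamma>. path \<gamma> \<longrightarrow> subordinate n t U \<gamma> \<longrightarrow> (\<forall>i\<in>{0..n}. \<gamma> (t i) = \<alpha> (t i)) \<longrightarrow>
              path_class (\<gamma> +++ reversepath \<beta>) \<notin> trivial_subgroup x)))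
    \<longleftrightarrow> (homotopically_close \<beta> \<alpha> \<longrightarrow> homotopic_paths UNIV \<beta> \<alpha>)"
    if \<alpha>: "\<alpha> \<in> paths_from x" and \<beta>: "\<beta> \<in> paths_from x" for \<alpha> \<beta>
  proof (cases "pathfinish \<alpha> = pathfinish \<beta>")
    case True
    have ends: "path \<alpha>" "path \<beta>" "pathstart \<alpha> = x" "pathstart \<beta> = x"
      using \<alpha> \<beta> by (auto simp: paths_from_def)
    have trivial: "path_class (\<gamma> +++ reversepath \<beta>) \<in> trivial_subgroup x
        \<longleftrightarrow> homotopic_paths UNIV \<gamma> \<beta>"
      if "unit_partition n t" "path \<gamma>" "\<forall>i\<in>{0..n}. \<gamma> (t i) = \<alpha> (t i)" for \<gamma> n t
    proof -
      have "\<gamma> (t 0) = \<alpha> (t 0)" "\<gamma> (t n) = \<alpha> (t n)"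
        using that by auto
      with that have "pathstart \<gamma> = x" "pathfinish \<gamma> = pathfinish \<beta>"
        using ends True by (auto simp: unit_partition_def pathstart_def pathfinish_def)
      with that ends show ?thesis
        by (intro path_class_join_reversepath_trivial_iff) auto
    qed
    have trivial_\<alpha>: "path_class (\<alpha> +++ reversepath \<beta>) \<in> trivial_subgroup x
        \<longleftrightarrow> homotopic_paths UNIV \<beta> \<alpha>"
      using path_class_join_reversepath_trivial_iff[of \<alpha> \<beta> x] ends True
        homotopic_paths_sym_eq[of UNIV \<alpha> \<beta>] by simp
    have separated: "(\<exists>n t U. unit_partition n t \<and> (\<forall>i\<in>{1..n}. open (U i)) \<and> subordinate n t U \<alpha> \<and>
           (\<forall>\<gamma>. path \<gamma> \<longrightarrow> subordinate n t U \<gamma> \<longrightarrow> (\<forall>i\<in>{0..n}. \<gamma> (t i) = \<alpha> (t i)) \<longrightarrow>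
              path_class (\<gamma> +++ reversepath \<beta>) \<notin> trivial_subgroup x))
      \<longleftrightarrow> \<not> homotopically_close \<beta> \<alpha>" (is "?L \<longleftrightarrow> _")
    proof
      assume "\<not> homotopically_close \<beta> \<alpha>"
      then obtain n t U where ntU: "unit_partition n t" "\<forall>i\<in>{1..n}. open (U i)" "subordinate n t U \<alpha>"
        "\<not> (\<exists>\<gamma>. path \<gamma> \<and> subordinate n t U \<gamma> \<and> (\<forall>i\<in>{0..n}. \<gamma> (t i) = \<alpha> (t i)) \<and>
              homotopic_paths UNIV \<gamma> \<beta>)"
        unfolding homotopically_close_def using ends True by metis
      show ?L
        using ntU trivial[OF ntU(1)]
        by (intro exI[of _ n] exI[of _ t] exI[of _ U] conjI) blast+
    next
      assume ?L
      then obtain n t U where ntU: "unit_partition n t" "\<forall>i\<in>{1..n}. open (U i)" "subordinate n t U \<alpha>"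
        and apart: "\<And>\<gamma>. path \<gamma> \<Longrightarrow> subordinate n t U \<gamma> \<Longrightarrow> \<forall>i\<in>{0..n}. \<gamma> (t i) = \<alpha> (t i) \<Longrightarrow>
              path_class (\<gamma> +++ reversepath \<beta>) \<notin> trivial_subgroup x"
        by blast
      show "\<not> homotopically_close \<beta> \<alpha>"
      proof
        assume "homotopically_close \<beta> \<alpha>"
        then obtain \<gamma> where "path \<gamma>" "subordinate n t U \<gamma>" "\<forall>i\<in>{0..n}. \<gamma> (t i) = \<alpha> (t i)"
            "homotopic_paths UNIV \<gamma> \<beta>"
          using ntU unfolding homotopically_close_def by blast
        then show False
          using apart trivial[OF ntU(1)] by blast
      qed
    qed
    show ?thesis
      unfolding separated trivial_\<alpha> using True by blast
  next
    case False
    then show ?thesis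
      by (auto simp: homotopically_close_def)
  qed
  show ?thesis
    unfolding homotopically_path_Hausdorff_def homotopically_path_Hausdorff_rel_def
    by (intro ball_cong refl key)
qed

section \<open>The equivalences\<close>

lemma pi1_qs_trivial_iff:
  fixes x :: "'a::topological_space"
  shows "pi1_qs x = trivial_subgroup x \<longleftrightarrow>
    (\<forall>f g. f \<in> loops_at x \<longrightarrow> homotopic_paths UNIV (const_path x) g \<longrightarrow> homotopically_close f g \<longrightarrow>
       homotopic_paths UNIV f (const_path x))"
proof -
  \<comment> \<open>The trivial class always belongs to \<open>pi1_qs x\<close>, so only one inclusion has content.\<close>
  have c: "path (const_path x)"
    using const_path_in_loops_at[of x] unfolding loops_at_def by blast
  then have "const_path x \<in> path_class (const_path x)"
    by (simp add: path_class_def)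
  then have "trivial_subgroup x \<subseteq> pi1_qs x"
    using homotopically_close_refl[OF c]
    unfolding trivial_subgroup_def pi1_qs_def path_class_in_fundamental_group_iff
    by (blast intro: const_path_in_loops_at)
  then have "pi1_qs x = trivial_subgroup x \<longleftrightarrow> pi1_qs x \<subseteq> trivial_subgroup x"
    by blast
  also have "\<dots> \<longleftrightarrow> (\<forall>f g. f \<in> loops_at x \<longrightarrow> homotopic_paths UNIV (const_path x) g \<longrightarrow>
      homotopically_close f g \<longrightarrow> path_class f = path_class (const_path x))"
    by (auto simp: pi1_qs_def trivial_subgroup_def path_class_in_fundamental_group_iff
        path_class_def[of "const_path x"])
  also have "\<dots> \<longleftrightarrow> (\<forall>f g. f \<in> loops_at x \<longrightarrow> homotopic_paths UNIV (const_path x) g \<longrightarrow>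
      homotopically_close f g \<longrightarrow> homotopic_paths UNIV f (const_path x))"
    using path_class_eq_iff by (metis homotopically_close_def)
  finally show ?thesis .
qed

theorem theorem3p13:
  fixes x :: "'a::topological_space"
  assumes "path_connected (UNIV :: 'a set)"
  shows "(homotopically_path_Hausdorff x \<longleftrightarrow> pi1_qs x = trivial_subgroup x) \<and>
         (pi1_qs x = trivial_subgroup x \<longleftrightarrow>
           (\<forall>f g. path_class f \<in> fundamental_group x \<longrightarrow> g \<in> loops_at x \<longrightarrow>
              homotopically_close f g \<longrightarrow> path_class f = path_class g)) \<and>
         ((\<forall>f g. path_class f \<in> fundamental_group x \<longrightarrow> g \<in> loops_at x \<longrightarrow>
              homotopically_close f g \<longrightarrow> path_class f = path_class g) \<longleftrightarrow>
           (\<forall>f g\<^sub>1 g\<^sub>2. path_class f \<in> fundamental_group x \<longrightarrow>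
              g\<^sub>1 \<in> loops_at x \<longrightarrow> g\<^sub>2 \<in> loops_at x \<longrightarrow>
              homotopically_close f g\<^sub>1 \<longrightarrow> homotopically_close f g\<^sub>2 \<longrightarrow>
              path_class g\<^sub>1 = path_class g\<^sub>2))"
proof -
  let ?P2 = "pi1_qs x = trivial_subgroup x"
  let ?P3 = "\<forall>f g. path_class f \<in> fundamental_group x \<longrightarrow> g \<in> loops_at x \<longrightarrow>
              homotopically_close f g \<longrightarrow> path_class f = path_class g"
  let ?P4 = "\<forall>f g\<^sub>1 g\<^sub>2. path_class f \<in> fundamental_group x \<longrightarrow>
              g\<^sub>1 \<in> loops_at x \<longrightarrow> g\<^sub>2 \<in> loops_at x \<longrightarrow>
              homotopically_close f g\<^sub>1 \<longrightarrow> homotopically_close f g\<^sub>2 \<longrightarrow>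
              path_class g\<^sub>1 = path_class g\<^sub>2"
  have one_three: "?P3" if "homotopically_path_Hausdorff x"
    using that unfolding homotopically_path_Hausdorff_iff_close path_class_in_fundamental_group_iff
    by (auto simp: paths_from_def loops_at_def path_class_eq_iff)
  have three_two: "?P2" if P3: "?P3"
    unfolding pi1_qs_trivial_iff
  proof (intro allI impI)
    fix f g assume f: "f \<in> loops_at x" and g: "homotopic_paths UNIV (const_path x) g"
      and close: "homotopically_close f g"
    have "g \<in> loops_at x"
      using f close by (auto simp: homotopically_close_def loops_at_def)
    with P3 f close have "path_class f = path_class g"
      by (simp add: path_class_in_fundamental_group_iff)
    then have "homotopic_paths UNIV f g"
      using f path_class_eq_iff by (auto simp: loops_at_def)
    then show "homotopic_paths UNIV f (const_path x)"
      using g homotopic_paths_sym homotopic_paths_trans by blast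
  qed
  have two_one: "homotopically_path_Hausdorff x" if P2: "?P2"
    unfolding homotopically_path_Hausdorff_iff_close
  proof (intro ballI impI)
    fix \<alpha> \<beta> assume "\<alpha> \<in> paths_from x" "\<beta> \<in> paths_from x" and close: "homotopically_close \<beta> \<alpha>"
    then have ends: "path \<alpha>" "path \<beta>" "pathstart \<alpha> = x" "pathstart \<beta> = x"
        "pathfinish \<alpha> = pathfinish \<beta>"
      by (auto simp: paths_from_def homotopically_close_def)
    \<comment> \<open>Appending the reverse of \<open>\<alpha>\<close> turns the pair into a loop close to a null-homotopic one.\<close>
    have "homotopically_close (\<beta> +++ reversepath \<alpha>) (\<alpha> +++ reversepath \<alpha>)"
      using close ends by (intro homotopically_close_join) auto
    moreover have "homotopic_paths UNIV (const_path x) (\<alpha> +++ reversepath \<alpha>)"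
      using homotopic_paths_sym[OF homotopic_paths_join_reversepath[of \<alpha>]] ends by simp
    moreover have "\<beta> +++ reversepath \<alpha> \<in> loops_at x"
      using ends by (simp add: loops_at_def)
    ultimately have "homotopic_paths UNIV (\<beta> +++ reversepath \<alpha>) (const_path x)"
      using P2 unfolding pi1_qs_trivial_iff by blast
    then show "homotopic_paths UNIV \<beta> \<alpha>"
      using homotopic_paths_join_reversepath_iff[of \<beta> \<alpha>] ends by simp
  qed
  have three_four: "?P3 \<longleftrightarrow> ?P4"
  proof
    assume ?P3
    then show ?P4 by metis
  next
    assume P4: ?P4
    show ?P3
    proof (intro allI impI)
      fix f g assume f: "path_class f \<in> fundamental_group x" and g: "g \<in> loops_at x"
        and close: "homotopically_close f g"
      have "f \<in> loops_at x"
        using f by (simp add: path_class_in_fundamental_group_iff)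
      moreover from this have "homotopically_close f f"
        by (intro homotopically_close_refl) (simp add: loops_at_def)
      ultimately show "path_class f = path_class g"
        using P4 f g close by blast
    qed
  qed
  show ?thesis
    using one_three three_two two_one three_four by argo
qed

end
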